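(* Let $P\subseteq\mathbb{R}^n$ be a polytope and let $A\in GL_n(\mathbb{R})$ satisfy $A^k=\mathrm{Id}$ for some natural number $k>0$. Then the following statements are equivalent: (1) $P+V(AP)$ is convex; (2) $P$ is vertex generated and $P=AP+x$ for some $x\in\mathbb{R}^n$. In particular, if $P-P=P-V(P)$, then $P$ is a centrally symmetric vertex generated polytope.
   Context: A polytope is the convex hull of a finite non-empty set of points; $V(P)$ denotes the set of vertices of the polytope $P$; $A+B=\{a+b:a\in A,b\in B\}$ and $A-B=\{a-b:a\in A,b\in B\}$ for sets $A,B$. A polytope $P\subset\mathbb{R}^n$ is called vertex generated if $P+V(P)=2P$. A polytope is centrally symmetric if $P=2c-P$ for some $c\in\mathbb{R}^n$. *)

theory Defs
  imports "HOL-Analysis.Analysis"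
begin

definition vertices :: "'a::real_vector set \<Rightarrow> 'a set" where
  "vertices P = {v. v extreme_point_of P}"

(* On sets, "+" is elementwise (HOL-Library.Set_Algebras), but "-" is set
   difference, so the elementwise difference needs its own name. *)
definition set_minus_elem :: "'a::minus set \<Rightarrow> 'a set \<Rightarrow> 'a set"  (infixl "\<ominus>" 65) where
  "A \<ominus> B = {a - b | a b. a \<in> A \<and> b \<in> B}"

definition vertex_generated :: "'a::real_vector set \<Rightarrow> bool" where
  "vertex_generated P \<longleftrightarrow> P + vertices P = (*\<^sub>R) 2 ` P"

definition centrally_symmetric :: "'a::real_vector set \<Rightarrow> bool" where
  "centrally_symmetric P \<longleftrightarrow> (\<exists>c. P = {2 *\<^sub>R c} \<ominus> P)"

(* "*" on vectors of vectors is componentwise, so "^" is not the matrix power. *)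
primrec matrix_power :: "real ^ 'n ^ 'n \<Rightarrow> nat \<Rightarrow> real ^ 'n ^ 'n" where
  "matrix_power A 0 = mat 1"
| "matrix_power A (Suc k) = A ** matrix_power A k"

end

theory Submission
  imports Defs
begin

text \<open>Let \<open>g = h\<^sub>P - h\<^sub>Q\<close> be the difference of the support functions of \<open>P\<close> and
  \<open>Q = A P\<close>. If \<open>P + V(Q)\<close> is convex, it equals \<open>P + Q\<close>, and this passes to the faces in each
  direction: whenever the face of \<open>Q\<close> is an edge, the face of \<open>P\<close> is at least as wide. On a
  generic line only vertices and edges of \<open>Q\<close> occur as faces, so all kinks of the piecewise linear
  \<open>g\<close> are convex there; by density and continuity \<open>g\<close> is sublinear. The sum of \<open>g\<close> over an orbit
  of the transpose of \<open>A\<close> telescopes to \<open>0\<close>, so the terms \<open>g(u) + g(-u) \<ge> 0\<close> all vanish.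
  Hence \<open>g\<close> is odd and sublinear, i.e. linear, and \<open>P\<close> is a translate of \<open>Q\<close>.
  For the centrally symmetric case take \<open>A = -Id\<close>.\<close>

section \<open>Support functions of finite sets\<close>

text \<open>This is the support function of \<open>convex hull V\<close>, taken over finitely many
  generators so that it is an attained maximum of linear functions. For empty \<open>V\<close> the
  value is unspecified, hence the non-emptiness hypotheses that recur below.\<close>

definition max_inner :: "'a::real_inner set \<Rightarrow> 'a \<Rightarrow> real" where
  "max_inner V u = Max ((\<bullet>) u ` V)"

lemma max_inner_ge: "finite V \<Longrightarrow> x \<in> V \<Longrightarrow> u \<bullet> x \<le> max_inner V u"
  unfolding max_inner_def by (intro Max_ge) auto

lemma max_inner_attained:
  assumes "finite V" "V \<noteq> {}"
  obtains x where "x \<in> V" "u \<bullet> x = max_inner V u"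
proof -
  have "max_inner V u \<in> (\<bullet>) u ` V"
    unfolding max_inner_def using assms by (intro Max_in) auto
  then show ?thesis using that by auto
qed

lemma max_inner_ge_hull:
  assumes "finite V" "x \<in> convex hull V"
  shows "u \<bullet> x \<le> max_inner V u"
proof -
  have "convex hull V \<subseteq> {x. u \<bullet> x \<le> max_inner V u}"
    using assms(1) by (intro hull_minimal convex_halfspace_le) (auto intro: max_inner_ge)
  then show ?thesis using assms(2) by auto
qed

lemma max_inner_scaleR:
  assumes "finite V" "V \<noteq> {}" "c \<ge> 0"
  shows "max_inner V (c *\<^sub>R u) = c * max_inner V u"
proof (rule antisym)
  obtain x where "x \<in> V" "(c *\<^sub>R u) \<bullet> x = max_inner V (c *\<^sub>R u)"
    using max_inner_attained assms by blast
  then show "max_inner V (c *\<^sub>R u) \<le> c * max_inner V u"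
    using assms max_inner_ge[of V x u] by (metis inner_scaleR_left mult_left_mono)
  obtain y where "y \<in> V" "u \<bullet> y = max_inner V u"
    using max_inner_attained assms by blast
  then show "c * max_inner V u \<le> max_inner V (c *\<^sub>R u)"
    using assms max_inner_ge[of V y "c *\<^sub>R u"] by simp
qed

lemma continuous_on_max_inner:
  assumes "finite V" "V \<noteq> {}"
  shows "continuous_on S (max_inner V)"
  using assms
proof (induction V rule: finite_ne_induct)
  case (singleton x)
  then show ?case by (auto simp: max_inner_def intro!: continuous_intros)
next
  case (insert x F)
  have "max_inner (insert x F) = (\<lambda>u. max (u \<bullet> x) (max_inner F u))"
    using insert by (simp add: max_inner_def fun_eq_iff inner_commute)
  with insert show ?case by (auto intro!: continuous_intros)
qed

text \<open>A point of one hull outside the other would be strictly separated from it, and the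
  separating functional would violate the inequality. Applied in both directions, this shows that
  support functions determine polytopes.\<close>

lemma hull_subset_if_max_inner_le:
  fixes V W :: "'a::euclidean_space set"
  assumes V: "finite V" and W: "finite W" "W \<noteq> {}"
    and le: "\<And>u. max_inner V u \<le> max_inner W u"
  shows "convex hull V \<subseteq> convex hull W"
proof
  fix x assume x: "x \<in> convex hull V"
  show "x \<in> convex hull W"
  proof (rule ccontr)
    assume "x \<notin> convex hull W"
    then obtain a b where ab: "a \<bullet> x < b" "\<forall>y\<in>convex hull W. a \<bullet> y > b"
      using separating_hyperplane_closed_point[of "convex hull W" x] W
      by (auto simp: finite_imp_compact_convex_hull compact_imp_closed)
    \<comment> \<open>The separation puts \<open>convex hull W\<close> on the side of larger values
      of \<open>a\<close>, so the maxima are compared in direction \<open>- a\<close>.\<close>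
    obtain y where "y \<in> W" "(- a) \<bullet> y = max_inner W (- a)"
      using max_inner_attained W by blast
    with ab have "max_inner W (-a) < - b"
      by (metis hull_inc inner_minus_left neg_less_iff_less)
    moreover have "- b < max_inner V (- a)"
      using max_inner_ge_hull[OF V x, of "-a"] ab(1) by simp
    ultimately show False using le[of "- a"] by linarith
  qed
qed

text \<open>The one-sided directional derivative of a support function is the support function of
  the face: points off the face trail by a positive gap, so only the face competes near
  \<open>u\<close>. As \<open>V\<close> is finite, the first-order expansion is exact for small
  \<open>s\<close>.\<close>

lemma max_inner_perturb:
  fixes V :: "'a::real_inner set" and u d :: 'a
  assumes V: "finite V" "V \<noteq> {}"
  defines "G \<equiv> {x \<in> V. u \<bullet> x = max_inner V u}"
  shows "eventually (\<lambda>s. max_inner V (u + s *\<^sub>R d) = max_inner V u + s * max_inner G d)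
           (at_right 0)"
proof -
  have finG: "finite G" using V by (auto simp: G_def)
  have "G \<noteq> {}" using max_inner_attained[OF V] by (auto simp: G_def)
  then obtain p where p: "p \<in> G" "d \<bullet> p = max_inner G d"
    using max_inner_attained finG by blast
  have "eventually (\<lambda>s. (u + s *\<^sub>R d) \<bullet> x \<le> max_inner V u + s * max_inner G d) (at_right 0)"
    if x: "x \<in> V" for x
  proof (cases "x \<in> G")
    case True
    have "eventually (\<lambda>s::real. s > 0) (at_right 0)" by (rule eventually_at_right_less)
    then show ?thesis
    proof eventually_elim
      case (elim s)
      then show ?case using max_inner_ge[OF finG True, of d] True
        by (simp add: G_def inner_add_left mult_left_mono)
    qed
  next
    case False
    with x have lt: "u \<bullet> x < max_inner V u"
      using max_inner_ge[OF V(1) x, of u] by (auto simp: G_def)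
    have "((\<lambda>s. (u + s *\<^sub>R d) \<bullet> x - (max_inner V u + s * max_inner G d)) \<longlongrightarrow>
        (u + 0 *\<^sub>R d) \<bullet> x - (max_inner V u + 0 * max_inner G d)) (at_right 0)"
      by (intro tendsto_intros)
    then have "eventually (\<lambda>s. (u + s *\<^sub>R d) \<bullet> x - (max_inner V u + s * max_inner G d) < 0) (at_right 0)"
      using lt by (intro order_tendstoD(2)) auto
    then show ?thesis by eventually_elim simp
  qed
  then have "eventually (\<lambda>s. \<forall>x\<in>V. (u + s *\<^sub>R d) \<bullet> x \<le> max_inner V u + s * max_inner G d) (at_right 0)"
    using V(1) by (simp add: eventually_ball_finite)
  then show ?thesis
  proof eventually_elim
    case (elim s)
    obtain x where "x \<in> V" "(u + s *\<^sub>R d) \<bullet> x = max_inner V (u + s *\<^sub>R d)"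
      using max_inner_attained[OF V] by blast
    moreover have "(u + s *\<^sub>R d) \<bullet> p \<le> max_inner V (u + s *\<^sub>R d)"
      using p(1) V by (intro max_inner_ge) (auto simp: G_def)
    moreover have "(u + s *\<^sub>R d) \<bullet> p = max_inner V u + s * max_inner G d"
      using p by (simp add: G_def inner_add_left)
    ultimately show ?case using elim by force
  qed
qed

text \<open>Extends the bound from the generators on the face to every point of the hull on it: the
  inequality in direction \<open>u + s *\<^sub>R d\<close>, for one small \<open>s > 0\<close>,
  reduces to the claim once the terms in \<open>u\<close> cancel.\<close>

lemma max_inner_face_ge:
  fixes V :: "'a::real_inner set"
  assumes V: "finite V" "V \<noteq> {}" and x: "x \<in> convex hull V" "u \<bullet> x = max_inner V u"
  shows "d \<bullet> x \<le> max_inner {x \<in> V. u \<bullet> x = max_inner V u} d"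
proof -
  obtain s :: real where "s > 0" and
    s: "max_inner V (u + s *\<^sub>R d) = max_inner V u + s * max_inner {x \<in> V. u \<bullet> x = max_inner V u} d"
    using eventually_happens[OF eventually_conj[OF eventually_at_right_less max_inner_perturb[OF V, of u d]]]
    by (auto simp: trivial_limit_at_right_real)
  have "(u + s *\<^sub>R d) \<bullet> x \<le> max_inner V (u + s *\<^sub>R d)"
    by (rule max_inner_ge_hull[OF V(1) x(1)])
  with s x \<open>s > 0\<close> show ?thesis by (simp add: inner_add_left)
qed

section \<open>Widths of faces\<close>

text \<open>If the edge of \<open>convex hull W\<close> were wider than the face of
  \<open>convex hull V\<close>, translates of that face to the two endpoints would leave a gap in
  the sum, although the sum with the whole edge has none.\<close>

lemma width_le_if_segment:
  fixes V W :: "'a::real_inner set" and u d :: 'a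
  assumes V: "finite V" "V \<noteq> {}" and W: "finite W" "W \<noteq> {}"
    and ext: "\<And>w. w \<in> W \<Longrightarrow> w extreme_point_of (convex hull W)"
    and sum: "convex hull V + W = convex hull V + convex hull W"
  defines "G \<equiv> {x \<in> V. u \<bullet> x = max_inner V u}"
  defines "H \<equiv> {x \<in> W. u \<bullet> x = max_inner W u}"
  assumes collinear: "\<And>x y z. x \<in> H \<Longrightarrow> y \<in> H \<Longrightarrow> z \<in> H \<Longrightarrow> x \<noteq> y \<Longrightarrow> \<exists>c. z - y = c *\<^sub>R (x - y)"
  shows "max_inner H d + max_inner H (- d) \<le> max_inner G d + max_inner G (- d)"
proof (rule ccontr)
  assume less: "\<not> ?thesis"
  have fin: "finite G" "finite H" using V W by (auto simp: G_def H_def)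
  obtain x where "x \<in> V" "u \<bullet> x = max_inner V u" by (rule max_inner_attained[OF V])
  moreover obtain y where "y \<in> W" "u \<bullet> y = max_inner W u" by (rule max_inner_attained[OF W])
  ultimately have ne: "G \<noteq> {}" "H \<noteq> {}" by (auto simp: G_def H_def)
  obtain v where v: "v \<in> H" "d \<bullet> v = max_inner H d"
    by (rule max_inner_attained[OF fin(2) ne(2)])
  obtain w where w: "w \<in> H" "(-d) \<bullet> w = max_inner H (-d)"
    by (rule max_inner_attained[OF fin(2) ne(2)])
  obtain p where p: "p \<in> G" "d \<bullet> p = max_inner G d"
    by (rule max_inner_attained[OF fin(1) ne(1)])
  define l where "l = d \<bullet> v - d \<bullet> w"
  define b where "b = max_inner G d + max_inner G (- d)"
  have "(- d) \<bullet> p \<le> max_inner G (- d)" using p fin by (intro max_inner_ge)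
  then have b: "0 \<le> b" using p by (simp add: b_def)
  have bl: "b < l" using less v w by (simp add: b_def l_def)
  then have l: "l > 0" using b by simp
  then have vw: "v \<noteq> w" by (auto simp: l_def)
  \<comment> \<open>All of the collinear set \<open>H\<close> lies between \<open>w\<close> and
    \<open>v\<close>, where \<open>d\<close> is minimal and maximal; an extreme point of the hull on
    this segment is an endpoint.\<close>
  have two: "z = v \<or> z = w" if z: "z \<in> H" for z
  proof -
    obtain c where c: "z - w = c *\<^sub>R (v - w)" using collinear[OF v(1) w(1) z vw] by blast
    then have "d \<bullet> z - d \<bullet> w = c * l"
      by (metis inner_diff_right inner_scaleR_right l_def)
    moreover have "d \<bullet> z \<le> d \<bullet> v" "d \<bullet> w \<le> d \<bullet> z"
      using max_inner_ge[OF fin(2) z, of d] max_inner_ge[OF fin(2) z, of "-d"] v w by auto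
    ultimately have "0 \<le> c * l" "c * l \<le> l" unfolding l_def by auto
    then have c01: "0 \<le> c" "c \<le> 1" using l by (auto simp: zero_le_mult_iff)
    have "z = (1 - c) *\<^sub>R w + c *\<^sub>R v" using c by (simp add: algebra_simps)
    then have "z \<in> closed_segment w v" using c01 by (auto simp: in_segment)
    moreover have "z extreme_point_of (convex hull W)" "v \<in> convex hull W" "w \<in> convex hull W"
      using ext z v w by (auto simp: H_def hull_inc)
    ultimately show ?thesis
      unfolding extreme_point_of_def open_segment_def by blast
  qed
  \<comment> \<open>Any value strictly between \<open>0\<close> and \<open>l - b\<close> places
    \<open>p + y\<close> inside the gap.\<close>
  define e where "e = (l - b) / 2"
  have e: "0 < e" "e < l - b" "e < l" using bl b by (auto simp: e_def)
  define y where "y = (1 - e / l) *\<^sub>R w + (e / l) *\<^sub>R v"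
  have "y \<in> closed_segment w v" using e l by (auto simp: in_segment y_def intro!: exI[of _ "e / l"])
  then have yW: "y \<in> convex hull W"
    using closed_segment_subset[of w "convex hull W" v] v w by (auto simp: H_def hull_inc)
  have dy: "d \<bullet> y = d \<bullet> w + e"
  proof -
    have "d \<bullet> y = d \<bullet> w + (e / l) * l"
      by (simp only: y_def l_def inner_add_right inner_scaleR_right) (simp add: algebra_simps diff_divide_distrib)
    then show ?thesis using l by simp
  qed
  have uy: "u \<bullet> y = max_inner W u"
    using v w by (simp add: y_def inner_add_right H_def algebra_simps)
  have "p + y \<in> convex hull V + W"
    unfolding sum using p yW by (auto simp: G_def hull_inc intro: set_plus_intro)
  then obtain p' z where pz: "p + y = p' + z" "p' \<in> convex hull V" "z \<in> W"
    by (auto elim: set_plus_elim)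
  \<comment> \<open>The \<open>u\<close>-values of \<open>p'\<close> and \<open>z\<close> add up to
    the sum of the two maxima, so each is maximal and both points lie on the faces in direction
    \<open>u\<close>.\<close>
  have "u \<bullet> p + u \<bullet> y = u \<bullet> p' + u \<bullet> z" by (metis inner_add_right pz(1))
  moreover have "u \<bullet> p = max_inner V u" using p by (simp add: G_def)
  moreover have "u \<bullet> p' \<le> max_inner V u" "u \<bullet> z \<le> max_inner W u"
    using max_inner_ge_hull[OF V(1) pz(2)] max_inner_ge[OF W(1) pz(3)] by auto
  ultimately have eq: "u \<bullet> p' = max_inner V u" "u \<bullet> z = max_inner W u" using uy by auto
  have p': "d \<bullet> p' \<le> max_inner G d" "(-d) \<bullet> p' \<le> max_inner G (-d)"
    unfolding G_def by (intro max_inner_face_ge V pz eq)+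
  have "d \<bullet> p + d \<bullet> y = d \<bullet> p' + d \<bullet> z"
    using pz(1) by (simp flip: inner_add_right)
  \<comment> \<open>If \<open>z = w\<close>, then \<open>p'\<close> exceeds the maximum of
    \<open>d\<close> on \<open>G\<close> by \<open>e\<close>; if \<open>z = v\<close>, it lies
    \<open>l - e > b\<close> below that maximum, hence below the minimum.\<close>
  moreover have "z = v \<or> z = w" using two pz eq by (auto simp: H_def)
  ultimately show False
    using p' p dy e by (auto simp: b_def l_def)
qed

section \<open>The difference of support functions is subadditive\<close>

text \<open>A maximum principle: subtracting the chord, the leftmost point of a positive maximum
  would violate the local midpoint inequality.\<close>
lemma midpoint_convex_if_locally:
  fixes g :: "real \<Rightarrow> real"
  assumes cont: "continuous_on {0..2} g"
    and loc: "\<And>t. eventually (\<lambda>s. 2 * g t \<le> g (t + s) + g (t - s)) (at_right 0)"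
  shows "2 * g 1 \<le> g 0 + g 2"
proof (rule ccontr)
  assume neg: "\<not> ?thesis"
  define f where "f t = g t - (g 0 + t / 2 * (g 2 - g 0))" for t
  have f: "f 0 = 0" "f 2 = 0" "f 1 > 0" using neg by (auto simp: f_def field_simps)
  have contf: "continuous_on {0..2} f"
    unfolding f_def by (intro continuous_intros cont) auto
  obtain m where m: "m \<in> {0..2}" "\<And>t. t \<in> {0..2} \<Longrightarrow> f t \<le> f m"
    using continuous_attains_sup[of "{0..2::real}" f] contf by auto
  define S where "S = {t \<in> {0..2}. f t = f m}"
  have "closed S" unfolding S_def
    by (rule continuous_closed_preimage_constant[OF contf closed_atLeastAtMost])
  then have "compact S" unfolding S_def
    by (metis (no_types, lifting) bounded_closed_interval bounded_subset compact_eq_bounded_closed mem_Collect_eq subsetI)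
  then obtain t where t: "t \<in> S" "\<And>t'. t' \<in> S \<Longrightarrow> t \<le> t'"
    using compact_attains_inf[of S] m by (auto simp: S_def)
  have "f m > 0" using m(2)[of 1] f by auto
  moreover have tm: "t \<in> {0..2}" "f t = f m" using t(1) by (simp_all add: S_def)
  ultimately have "t \<noteq> 0" "t \<noteq> 2" using f by auto
  then have t02: "0 < t" "t < 2" using tm(1) by auto
  have "eventually (\<lambda>s. s > 0 \<and> s < min t (2 - t) \<and> 2 * g t \<le> g (t + s) + g (t - s)) (at_right 0)"
    using t02 by (intro eventually_conj loc eventually_at_right_less eventually_at_rightI[of 0 "min t (2-t)"]) auto
  then obtain s where s: "s > 0" "s < t" "s < 2 - t" "2 * g t \<le> g (t + s) + g (t - s)"
    using eventually_happens[of _ "at_right (0::real)"] by (auto simp: trivial_limit_at_right_real)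
  have "2 * f t \<le> f (t + s) + f (t - s)" using s(4) by (simp add: f_def field_simps)
  moreover have "f (t + s) \<le> f t" using m(2)[of "t + s"] tm s t02 by auto
  moreover have "f (t - s) < f t"
  proof -
    have "t - s \<notin> S" using t(2)[of "t - s"] s by auto
    then show ?thesis using m(2)[of "t - s"] tm s t02 by (auto simp: S_def)
  qed
  ultimately show False by linarith
qed

text \<open>Finitely many hyperplanes form a negligible set, so their complement is dense, and the
  set where a continuous \<open>f\<close> is nonnegative is closed.\<close>

lemma nonneg_if_nonneg_off_hyperplanes:
  fixes f :: "'a::euclidean_space \<Rightarrow> real"
  assumes "finite C" "0 \<notin> C" "continuous_on UNIV f"
    and nonneg: "\<And>x. (\<And>c. c \<in> C \<Longrightarrow> c \<bullet> x \<noteq> 0) \<Longrightarrow> f x \<ge> 0"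
  shows "f x \<ge> 0"
proof -
  let ?N = "\<Union>c\<in>C. {x. c \<bullet> x = 0}"
  have "negligible ?N"
    using assms(1,2) by (intro negligible_Union) (auto intro!: negligible_hyperplane)
  then have "interior ?N = {}"
    using open_not_negligible[of "interior ?N"] negligible_subset interior_subset by blast
  then have "closure (- ?N) = UNIV"
    by (simp only: closure_complement) simp
  moreover have "closure (- ?N) \<subseteq> {x. f x \<ge> 0}"
    using nonneg by (intro closure_minimal closed_Collect_le continuous_intros assms) auto
  ultimately show ?thesis by auto
qed

text \<open>Along a generic line the comparison of widths makes the second differences of
  \<open>g\<close> nonnegative locally, which the maximum principle globalises; continuity then
  covers all \<open>u\<close> and \<open>d\<close>.\<close>

lemma max_inner_diff_midpoint:
  fixes V W :: "'a::euclidean_space set"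
  assumes V: "finite V" "V \<noteq> {}" and W: "finite W" "W \<noteq> {}"
    and ext: "\<And>w. w \<in> W \<Longrightarrow> w extreme_point_of (convex hull W)"
    and sum: "convex hull V + W = convex hull V + convex hull W"
  defines "g \<equiv> \<lambda>u. max_inner V u - max_inner W u"
  shows "2 * g (u + d) \<le> g u + g (u + 2 *\<^sub>R d)"
proof -
  have cont: "continuous_on S g" for S
    unfolding g_def by (intro continuous_intros continuous_on_max_inner V W)
  have cont': "continuous_on S (\<lambda>x. g (h x))" if "continuous_on S h" for S and h :: "'b::topological_space \<Rightarrow> 'a"
    using continuous_on_compose2[OF cont[of UNIV] that] by auto
  \<comment> \<open>These differences include all edge directions of
    \<open>convex hull W\<close>.\<close>
  define D where "D = (\<lambda>(v, w). v - w) ` (W \<times> W) - {0}"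
  have finD: "finite D" unfolding D_def using W by simp
  have DI: "v - w \<in> D" if "v \<in> W" "w \<in> W" "v \<noteq> w" for v w
    using that by (auto simp: D_def)
  \<comment> \<open>\<open>r u \<delta> \<epsilon> \<bullet> d\<close> is the determinant of the 2
    by 2 matrix of inner products of \<open>u\<close> and \<open>d\<close> with
    \<open>\<delta>\<close> and \<open>\<epsilon>\<close>. It vanishes if some
    \<open>u + t *\<^sub>R d\<close> is orthogonal to both, and
    \<open>r u \<delta> \<epsilon> = 0\<close> makes them parallel once \<open>u\<close> is
    orthogonal to neither.\<close>
  define r where "r u \<delta> \<epsilon> = (u \<bullet> \<delta>) *\<^sub>R \<epsilon> - (u \<bullet> \<epsilon>) *\<^sub>R \<delta>" for u \<delta> \<epsilon> :: 'a
  text \<open>If \<open>u\<close> and \<open>d\<close> are generic, then the line through \<open>u\<close> in direction \<open>d\<close> meets only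
    normal cones of vertices and edges of \<open>convex hull W\<close>.\<close>
  have generic: "2 * g (u + d) \<le> g u + g (u + 2 *\<^sub>R d)"
    if u: "\<And>\<delta>. \<delta> \<in> D \<Longrightarrow> \<delta> \<bullet> u \<noteq> 0"
      and d: "\<And>\<delta> \<epsilon>. \<delta> \<in> D \<Longrightarrow> \<epsilon> \<in> D \<Longrightarrow> r u \<delta> \<epsilon> \<noteq> 0 \<Longrightarrow> r u \<delta> \<epsilon> \<bullet> d \<noteq> 0" for u d
  proof -
    have "2 * g (u + 1 *\<^sub>R d) \<le> g (u + 0 *\<^sub>R d) + g (u + 2 *\<^sub>R d)"
    proof (rule midpoint_convex_if_locally)
      show "continuous_on {0..2} (\<lambda>t. g (u + t *\<^sub>R d))"
        by (intro cont' continuous_intros)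
    next
      fix t :: real
      define q where "q = u + t *\<^sub>R d"
      define G where "G = {x \<in> V. q \<bullet> x = max_inner V q}"
      define H where "H = {x \<in> W. q \<bullet> x = max_inner W q}"
      have "\<exists>c. z - y = c *\<^sub>R (x - y)" if xyz: "x \<in> H" "y \<in> H" "z \<in> H" "x \<noteq> y" for x y z
      proof (cases "z = y")
        case True
        then show ?thesis by (intro exI[of _ 0]) simp
      next
        case False
        have D: "x - y \<in> D" "z - y \<in> D" using xyz False by (auto intro!: DI simp: H_def)
        have "q \<bullet> (x - y) = 0" "q \<bullet> (z - y) = 0"
          using xyz by (auto simp: H_def inner_diff_right)
        then have e: "u \<bullet> (x - y) = - t * (d \<bullet> (x - y))" "u \<bullet> (z - y) = - t * (d \<bullet> (z - y))"
          by (auto simp: q_def inner_add_left)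
        have "r u (x - y) (z - y) \<bullet> d = (u \<bullet> (x - y)) * (d \<bullet> (z - y)) - (u \<bullet> (z - y)) * (d \<bullet> (x - y))"
          unfolding r_def inner_commute[of _ d] by (simp only: inner_diff_right inner_scaleR_right)
        also have "\<dots> = 0" unfolding e by simp
        finally have "r u (x - y) (z - y) = 0" using d D by blast
        then have "(u \<bullet> (x - y)) *\<^sub>R (z - y) = (u \<bullet> (z - y)) *\<^sub>R (x - y)"
          by (simp add: r_def)
        moreover have "u \<bullet> (x - y) \<noteq> 0" using u[OF D(1)] by (simp add: inner_commute)
        ultimately have "z - y = ((u \<bullet> (z - y)) / (u \<bullet> (x - y))) *\<^sub>R (x - y)"
          by (metis (no_types, lifting) divide_inverse_commute scaleR_left_imp_eq scaleR_scaleR nonzero_mult_div_cancel_left times_divide_eq_right)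
        then show ?thesis by blast
      qed
      then have width: "max_inner H d + max_inner H (- d) \<le> max_inner G d + max_inner G (- d)"
        unfolding G_def H_def by (intro width_le_if_segment[OF V W ext sum]) auto
      \<comment> \<open>By these expansions the second difference of \<open>g\<close> at
        \<open>q\<close> with step \<open>s\<close> is \<open>s\<close> times the width of
        \<open>G\<close> minus the width of \<open>H\<close> along \<open>d\<close>.\<close>
      have "eventually (\<lambda>s. max_inner V (q + s *\<^sub>R d) = max_inner V q + s * max_inner G d) (at_right 0)"
        "eventually (\<lambda>s. max_inner V (q + s *\<^sub>R (-d)) = max_inner V q + s * max_inner G (-d)) (at_right 0)"
        "eventually (\<lambda>s. max_inner W (q + s *\<^sub>R d) = max_inner W q + s * max_inner H d) (at_right 0)"
        "eventually (\<lambda>s. max_inner W (q + s *\<^sub>R (-d)) = max_inner W q + s * max_inner H (-d)) (at_right 0)"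
        "eventually (\<lambda>s::real. s > 0) (at_right 0)"
        unfolding G_def H_def by (intro max_inner_perturb V W eventually_at_right_less)+
      then show "eventually (\<lambda>s. 2 * g (u + t *\<^sub>R d) \<le> g (u + (t + s) *\<^sub>R d) + g (u + (t - s) *\<^sub>R d)) (at_right 0)"
      proof eventually_elim
        case (elim s)
        have q: "u + (t + s) *\<^sub>R d = q + s *\<^sub>R d" "u + (t - s) *\<^sub>R d = q + s *\<^sub>R (- d)"
          by (auto simp: q_def algebra_simps)
        have "s * (max_inner H d + max_inner H (- d)) \<le> s * (max_inner G d + max_inner G (- d))"
          using width elim(5) by (intro mult_left_mono) auto
        then show ?case unfolding q g_def elim(1-4) q_def[symmetric]
          by (simp add: algebra_simps)
      qed
    qed
    then show ?thesis by simp
  qed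
  have "g u + g (u + 2 *\<^sub>R d) - 2 * g (u + d) \<ge> 0"
  \<comment> \<open>Genericity is removed in two layers, \<open>u\<close> outside and
    \<open>d\<close> inside, because the hyperplanes that \<open>d\<close> must avoid depend on
    \<open>u\<close>.\<close>
  proof (rule nonneg_if_nonneg_off_hyperplanes[where C = D and f = "\<lambda>u. g u + g (u + 2 *\<^sub>R d) - 2 * g (u + d)"])
    show "continuous_on UNIV (\<lambda>u. g u + g (u + 2 *\<^sub>R d) - 2 * g (u + d))"
      by (intro continuous_intros cont')
    fix u assume u: "\<And>\<delta>. \<delta> \<in> D \<Longrightarrow> \<delta> \<bullet> u \<noteq> 0"
    show "g u + g (u + 2 *\<^sub>R d) - 2 * g (u + d) \<ge> 0"
    proof (rule nonneg_if_nonneg_off_hyperplanes[where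
          C = "(\<lambda>(\<delta>, \<epsilon>). r u \<delta> \<epsilon>) ` (D \<times> D) - {0}" and f = "\<lambda>d. g u + g (u + 2 *\<^sub>R d) - 2 * g (u + d)"])
      show "finite ((\<lambda>(\<delta>, \<epsilon>). r u \<delta> \<epsilon>) ` (D \<times> D) - {0})"
        using finD by simp
      show "continuous_on UNIV (\<lambda>d. g u + g (u + 2 *\<^sub>R d) - 2 * g (u + d))"
        by (intro continuous_intros cont')
      fix d assume "\<And>c. c \<in> (\<lambda>(\<delta>, \<epsilon>). r u \<delta> \<epsilon>) ` (D \<times> D) - {0} \<Longrightarrow> c \<bullet> d \<noteq> 0"
      then show "g u + g (u + 2 *\<^sub>R d) - 2 * g (u + d) \<ge> 0"
        using generic[OF u, of d] by fastforce
    qed simp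
  qed (use finD in \<open>simp_all add: D_def\<close>)
  then show ?thesis by simp
qed

text \<open>For a positively homogeneous function midpoint convexity is subadditivity; the midpoint
  of \<open>u\<close> and \<open>v\<close> is reached with step
  \<open>(1/2) *\<^sub>R (v - u)\<close>.\<close>

lemma max_inner_diff_subadditive:
  fixes V W :: "'a::euclidean_space set"
  assumes V: "finite V" "V \<noteq> {}" and W: "finite W" "W \<noteq> {}"
    and ext: "\<And>w. w \<in> W \<Longrightarrow> w extreme_point_of (convex hull W)"
    and sum: "convex hull V + W = convex hull V + convex hull W"
  defines "g \<equiv> \<lambda>u. max_inner V u - max_inner W u"
  shows "g (u + v) \<le> g u + g v"
proof -
  have "g (2 *\<^sub>R x) = 2 * g x" for x
    unfolding g_def using max_inner_scaleR[of V 2] max_inner_scaleR[of W 2] V W by simp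
  from this[of "u + (1/2) *\<^sub>R (v - u)"] have "g (u + v) = 2 * g (u + (1/2) *\<^sub>R (v - u))"
    by (simp add: scaleR_add_right scaleR_2)
  also have "\<dots> \<le> g u + g (u + 2 *\<^sub>R ((1/2) *\<^sub>R (v - u)))"
    unfolding g_def by (rule max_inner_diff_midpoint[OF V W ext sum])
  finally show ?thesis by simp
qed

section \<open>Linear maps of finite order\<close>

lemma convex_hull_vertices:
  fixes P :: "'a::euclidean_space set"
  assumes "polytope P"
  shows "convex hull (vertices P) = P"
  unfolding vertices_def
  using Krein_Milman_Minkowski[of P, symmetric] assms
  by (simp add: polytope_imp_compact polytope_imp_convex)

lemma finite_vertices:
  fixes P :: "'a::euclidean_space set"
  shows "polytope P \<Longrightarrow> finite (vertices P)"
  unfolding vertices_def by (simp add: finite_polyhedron_extreme_points polytope_imp_polyhedron)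

text \<open>Convex hulls commute with Minkowski sums, so the hull of the left side is always
  \<open>P + Q\<close>.\<close>

lemma plus_vertices_eq_if_convex:
  fixes P Q :: "'a::euclidean_space set"
  assumes "polytope P" "polytope Q" "convex (P + vertices Q)"
  shows "P + vertices Q = P + Q"
proof -
  have "P + Q = convex hull (P + vertices Q)"
    using assms by (simp add: convex_hull_set_plus convex_hull_vertices polytope_imp_convex hull_same)
  then show ?thesis using assms(3) by (simp add: hull_same)
qed

lemma translate_if_convex_plus_vertices:
  fixes P :: "'a::euclidean_space set" and f :: "'a \<Rightarrow> 'a"
  assumes P: "polytope P" "P \<noteq> {}" and f: "linear f" and k: "k > 0" "f ^^ k = id"
    and conv: "convex (P + vertices (f ` P))"
  shows "\<exists>x. P = f ` P + {x}"
proof -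
  define V where "V = vertices P"
  define W where "W = vertices (f ` P)"
  have Q: "polytope (f ` P)" using P f by (simp add: polytope_linear_image)
  have hV: "convex hull V = P" and hW: "convex hull W = f ` P"
    using P Q by (simp_all add: V_def W_def convex_hull_vertices)
  have V: "finite V" "V \<noteq> {}" and W: "finite W" "W \<noteq> {}"
    using P Q hV hW by (auto simp: V_def W_def finite_vertices)
  have VP: "V \<subseteq> P" and WP: "W \<subseteq> f ` P"
    using hull_subset[of V convex] hull_subset[of W convex] hV hW by auto
  define g where "g u = max_inner V u - max_inner W u" for u
  have ext: "w extreme_point_of (convex hull W)" if "w \<in> W" for w
    using that hW by (simp add: W_def vertices_def)
  have sum: "convex hull V + W = convex hull V + convex hull W"
    using plus_vertices_eq_if_convex[OF P(1) Q conv] unfolding hV hW by (simp add: W_def)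
  have sub: "g (u + v) \<le> g u + g v" for u v
    unfolding g_def by (rule max_inner_diff_subadditive[OF V W ext sum])
  have adj: "adjoint f u \<bullet> x = u \<bullet> f x" for u x
    by (metis adjoint_works[OF f] inner_commute)
  \<comment> \<open>Each maximum is attained at a point whose image or preimage under
    \<open>f\<close> lies in the other hull.\<close>
  have W_adj: "max_inner W u = max_inner V (adjoint f u)" for u
  proof (rule antisym)
    obtain w where w: "w \<in> W" "u \<bullet> w = max_inner W u" using max_inner_attained[OF W] by blast
    then obtain p where p: "p \<in> P" "w = f p" using WP by blast
    then show "max_inner W u \<le> max_inner V (adjoint f u)"
      using max_inner_ge_hull[of V p "adjoint f u"] V hV w p by (simp add: adj)
    obtain v where v: "v \<in> V" "adjoint f u \<bullet> v = max_inner V (adjoint f u)"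
      using max_inner_attained[OF V] by blast
    have "f v \<in> convex hull W" using v(1) VP hW by blast
    then show "max_inner V (adjoint f u) \<le> max_inner W u"
      using max_inner_ge_hull[of W "f v" u] W v by (simp add: adj)
  qed
  have adj_pow: "((adjoint f ^^ n) u) \<bullet> x = u \<bullet> (f ^^ n) x" for n u x
  proof (induction n arbitrary: u)
    case (Suc n)
    show ?case by (simp only: funpow_Suc_right o_apply Suc adj) (simp add: funpow_swap1)
  qed simp
  have "(adjoint f ^^ k) u = u" for u
    using adj_pow[of k u] k by (simp add: vector_eq_rdot[of _ u, symmetric])
  \<comment> \<open>By \<open>W_adj\<close>, each term is the support function of \<open>P\<close>
    at one orbit point minus its value at the next, and the orbit closes up after \<open>k\<close>
    steps.\<close>
  then have orbit: "(\<Sum>i<k. g ((adjoint f ^^ i) u)) = 0" for u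
    using sum_lessThan_telescope'[of "\<lambda>i. max_inner V ((adjoint f ^^ i) u)" k]
    by (simp add: g_def W_adj)
  have g0: "g 0 = 0"
    using max_inner_scaleR[OF V, of 0 0] max_inner_scaleR[OF W, of 0 0] by (simp add: g_def)
  have neg: "g (- u) = - g u" for u
  proof -
    \<comment> \<open>Subadditivity and \<open>g 0 = 0\<close> make every \<open>s i\<close>
      nonnegative; their sum vanishes, so \<open>s 0\<close>, the term for \<open>u\<close> itself,
      vanishes too.\<close>
    define s where "s i = g ((adjoint f ^^ i) u) + g ((adjoint f ^^ i) (- u))" for i
    have "(adjoint f ^^ i) (- u) = - (adjoint f ^^ i) u" for i
      by (induction i) (simp_all add: linear_neg[OF adjoint_linear[OF f]])
    then have "s i \<ge> 0" for i
      using sub[of "(adjoint f ^^ i) u" "(adjoint f ^^ i) (- u)"] g0 by (simp add: s_def)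
    moreover have "(\<Sum>i<k. s i) = 0"
      using orbit by (simp add: s_def sum.distrib)
    ultimately have "s 0 = 0" using k(1) by (simp add: sum_nonneg_eq_0_iff)
    then show ?thesis by (simp add: s_def)
  qed
  \<comment> \<open>Subadditivity at \<open>- u\<close> and \<open>- v\<close> becomes the reverse
    inequality by oddness.\<close>
  have add: "g (u + v) = g u + g v" for u v
    using sub[of u v] sub[of "- u" "- v"] neg[of "u + v"] neg[of u] neg[of v] by simp
  have scale: "g (c *\<^sub>R u) = c * g u" for c u
  proof (cases "c \<ge> 0")
    case True
    then show ?thesis using max_inner_scaleR[of V c u] max_inner_scaleR[of W c u] V W
      by (simp add: g_def algebra_simps)
  next
    case False
    then have "g ((- c) *\<^sub>R u) = (- c) * g u"
      using max_inner_scaleR[of V "-c" u] max_inner_scaleR[of W "-c" u] V W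
      by (simp add: g_def algebra_simps)
    then show ?thesis using neg[of "c *\<^sub>R u"] by simp
  qed
  have "linear g" using add scale by (intro linearI) auto
  \<comment> \<open>The Riesz vector of the linear functional \<open>g\<close>; it is the
    translation sought.\<close>
  define x where "x = adjoint g (1::real)"
  have g: "g u = u \<bullet> x" for u
    using adjoint_works[OF \<open>linear g\<close>, of u "1::real"] by (simp add: x_def inner_commute)
  define W' where "W' = W + {x}"
  have W': "finite W'" "W' \<noteq> {}" using W by (auto simp: W'_def set_plus_def)
  have "max_inner W' u = max_inner V u" for u
  proof -
    have "max_inner W' u = Max ((\<lambda>w. u \<bullet> w + u \<bullet> x) ` W)"
      unfolding max_inner_def W'_def set_plus_def by (intro arg_cong[of _ _ Max]) (force simp: inner_add_right image_iff)
    also have "\<dots> = max_inner W u + u \<bullet> x"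
      unfolding max_inner_def using W by (intro Max_add_commute)
    finally show ?thesis using g[of u] by (simp add: g_def)
  qed
  then have "convex hull V = convex hull W'"
    using V W' by (intro antisym hull_subset_if_max_inner_le) auto
  also have "\<dots> = f ` P + {x}" unfolding W'_def by (simp add: convex_hull_set_plus hW)
  finally show ?thesis using hV by auto
qed

section \<open>Vertex generation and the equivalence for linear maps\<close>

lemma vertices_translation:
  fixes P :: "'a::real_vector set"
  shows "vertices (P + {x}) = vertices P + {x}"
proof -
  have eq: "S + {x} = (+) x ` S" for S by (auto simp: set_plus_def add.commute)
  show ?thesis unfolding eq vertices_def extreme_points_of_translation by simp
qed

text \<open>A sum of two points is twice their midpoint. This lets vertex generation be read as
  convexity of \<open>P + vertices P\<close>.\<close>

lemma plus_self_eq_scaleR_2: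
  fixes P :: "'a::real_vector set"
  assumes "convex P"
  shows "P + P = (*\<^sub>R) 2 ` P"
proof
  show "P + P \<subseteq> (*\<^sub>R) 2 ` P"
  proof
    fix z assume "z \<in> P + P"
    then obtain x y where xy: "x \<in> P" "y \<in> P" "z = x + y" by (auto elim: set_plus_elim)
    then have "(1/2) *\<^sub>R x + (1/2) *\<^sub>R y \<in> P" using assms by (intro convexD) auto
    moreover have "z = 2 *\<^sub>R ((1/2) *\<^sub>R x + (1/2) *\<^sub>R y)" using xy by (simp add: scaleR_add_right)
    ultimately show "z \<in> (*\<^sub>R) 2 ` P" by blast
  qed
qed (auto simp: scaleR_2)

text \<open>Once \<open>P\<close> is a translate of its image, their vertex sets differ by the same
  translation, so convexity of the sum is convexity of \<open>P + vertices P\<close>, which is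
  vertex generation. That convexity forces the translate is the preceding result on maps of finite
  order.\<close>

lemma convex_plus_vertices_iff:
  fixes P :: "'a::euclidean_space set" and f :: "'a \<Rightarrow> 'a"
  assumes P: "polytope P" "P \<noteq> {}" and f: "linear f" and k: "k > 0" "f ^^ k = id"
  shows "convex (P + vertices (f ` P)) \<longleftrightarrow> vertex_generated P \<and> (\<exists>x. P = f ` P + {x})"
proof -
  have P2: "P + P = (*\<^sub>R) 2 ` P"
    using P by (intro plus_self_eq_scaleR_2 polytope_imp_convex)
  have gen: "vertex_generated P \<longleftrightarrow> convex (P + vertices (f ` P))" if x: "P = f ` P + {x}" for x
  proof -
    have "P + vertices P = (P + vertices (f ` P)) + {x}"
      using vertices_translation[of "f ` P" x] x by (simp add: add.assoc)
    also have "\<dots> = (+) x ` (P + vertices (f ` P))"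
      by (auto simp: set_plus_def add.commute)
    finally have "convex (P + vertices P) \<longleftrightarrow> convex (P + vertices (f ` P))"
      by (simp add: convex_translation_eq)
    moreover have "vertex_generated P \<longleftrightarrow> convex (P + vertices P)"
    proof
      assume "vertex_generated P"
      then show "convex (P + vertices P)"
        using P by (simp add: vertex_generated_def convex_scaling polytope_imp_convex)
    next
      assume "convex (P + vertices P)"
      then show "vertex_generated P"
        using plus_vertices_eq_if_convex[OF P(1) P(1)] P2 by (simp add: vertex_generated_def)
    qed
    ultimately show ?thesis by simp
  qed
  then show ?thesis using translate_if_convex_plus_vertices[OF P f k] by blast
qed

section \<open>Passage to matrices and to point reflection\<close>

lemma matrix_power_mult_vec: "matrix_power A k *v x = ((*v) A ^^ k) x"
  by (induction k) (auto simp flip: matrix_vector_mul_assoc)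

text \<open>Extreme points are singleton faces, and injective linear maps preserve and reflect
  faces.\<close>

lemma vertices_uminus:
  fixes P :: "'a::real_vector set"
  shows "vertices (uminus ` P) = uminus ` vertices P"
proof -
  have "- v extreme_point_of uminus ` P \<longleftrightarrow> v extreme_point_of P" for v
    using face_of_linear_image[of uminus "{v}" P] by (simp add: face_of_singleton linear_uminus)
  then show ?thesis
    unfolding vertices_def by (intro equalityI subsetI) (metis (mono_tags, lifting) image_eqI mem_Collect_eq minus_minus, auto)
qed

theorem theorem5p5:
  fixes P :: "(real ^ 'n) set"
  assumes "polytope P" and "P \<noteq> {}"
  shows "(\<forall>(A :: real ^ 'n ^ 'n) (k :: nat).
            invertible A \<longrightarrow> k > 0 \<longrightarrow> matrix_power A k = mat 1 \<longrightarrow>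
              (convex (P + vertices ((*v) A ` P)) \<longleftrightarrow>
               vertex_generated P \<and> (\<exists>x. P = (*v) A ` P + {x})))
       \<and> (P \<ominus> P = P \<ominus> vertices P \<longrightarrow>
            centrally_symmetric P \<and> vertex_generated P)"
proof (intro conjI allI impI)
  fix A :: "real ^ 'n ^ 'n" and k :: nat
  assume "k > 0" "matrix_power A k = mat 1"
  then have "(*v) A ^^ k = id"
    using matrix_power_mult_vec[of A k] by (auto simp: fun_eq_iff)
  then show "convex (P + vertices ((*v) A ` P)) \<longleftrightarrow>
      vertex_generated P \<and> (\<exists>x. P = (*v) A ` P + {x})"
    using assms \<open>k > 0\<close> by (intro convex_plus_vertices_iff) auto
next
  assume eq: "P \<ominus> P = P \<ominus> vertices P"
  have minus: "S \<ominus> T = S + uminus ` T" for S T :: "(real ^ 'n) set"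
    unfolding set_minus_elem_def set_plus_def by force
  \<comment> \<open>The difference body is always convex, so the assumed equality makes the sum of
    \<open>P\<close> with the vertices of its reflection convex; the reflection has order 2.\<close>
  have "convex (P + uminus ` P)"
    using assms by (intro convex_set_plus convex_negations polytope_imp_convex)
  then have "convex (P + vertices (uminus ` P))"
    using eq by (simp add: minus vertices_uminus)
  moreover have "(uminus :: real ^ 'n \<Rightarrow> _) ^^ 2 = id"
    by (auto simp: fun_eq_iff numeral_2_eq_2)
  ultimately obtain x where x: "P = uminus ` P + {x}" and gen: "vertex_generated P"
    using convex_plus_vertices_iff[OF assms linear_uminus, of 2] by auto
  \<comment> \<open>The centre is half of the translation vector.\<close>
  have "P = {2 *\<^sub>R ((1/2) *\<^sub>R x)} \<ominus> P"
    using x by (simp add: minus add.commute)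
  then have "centrally_symmetric P"
    unfolding centrally_symmetric_def by blast
  with gen show "centrally_symmetric P" "vertex_generated P" by auto
qed

end
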